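(* Let $0<\beta_l\le\beta_u$ and $0<\eta<\sqrt2-1$. For $z\in\mathcal N(\eta,\beta_l,\beta_u)$, let $$W=H_x+\frac{ss^\top}{\nu\mu^2}-\frac{g_xg_x^\top}{\nu}.$$ Then $$(1-\delta)\,H_x\ \preceq\ W\ \preceq\ (1+\delta)\,H_x,$$ where $\delta:=\eta^2+2\eta<1$.
   Context: $\mathbb K\subseteq\mathbb R^n$ ($n\ge1$) is a proper cone (closed, convex, pointed, nonempty interior; in general not symmetric) with dual cone $\mathbb K^*=\{s:\langle s,x\rangle\ge0\ \forall x\in\mathbb K\}$. $F:\operatorname{int}(\mathbb K)\to\mathbb R$ is a $\nu$-logarithmically homogeneous self-concordant barrier ($\nu$-LHSCB): $F$ is convex, $C^3$, satisfies $|D^3F(x)[h,h,h]|\le2(D^2F(x)[h,h])^{3/2}$, tends to $+\infty$ along every sequence in $\operatorname{int}(\mathbb K)$ converging to a boundary point, and $F(tx)=F(x)-\nu\log t$ for $t>0$. It is a known fact that $\nu\ge1$ and $\nabla^2F(x)\succ0$. Write $g_x=\nabla F(x)$, $H_x=\nabla^2F(x)$, $\|v\|_x^*=\langle v,H_x^{-1}v\rangle^{1/2}$. Points are $z=(\bar x;y;\bar s)$ with $\bar x=(x;\tau)\in\mathbb K\times\mathbb R_+$, $y\in\mathbb R^m$, $\bar s=(s;\kappa)\in\mathbb K^*\times\mathbb R_+$; $\mathcal F=(\mathbb K\times\mathbb R_+)\times\mathbb R^m\times(\mathbb K^*\times\mathbb R_+)$; $\mu=\langle x,s\rangle/\nu$;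 $\psi(x,s,\mu)=s+\mu g_x$; and $$\mathcal N(\eta,\beta_l,\beta_u)=\{z\in\operatorname{int}(\mathcal F):\ \|\psi(x,s,\mu)\|_x^*\le\eta\mu,\ \beta_l\mu\le\kappa\tau\le\beta_u\mu\}.$$ $\preceq$ is the Loewner order on symmetric matrices. *)

theory Defs
  imports "HOL-Analysis.Analysis"
begin

text \<open>Iterated directional derivatives: \<open>dir_deriv f [h\<^sub>1, \<dots>, h\<^sub>k] x\<close> is
  \<open>D\<^sup>kf(x)[h\<^sub>1, \<dots>, h\<^sub>k]\<close>, the last direction of the list being differentiated first.\<close>

primrec dir_deriv ::
    "('a::real_normed_vector \<Rightarrow> real) \<Rightarrow> 'a list \<Rightarrow> 'a \<Rightarrow> real" where
  "dir_deriv f [] = f"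
| "dir_deriv f (h # hs) = (\<lambda>x. frechet_derivative (dir_deriv f hs) (at x) h)"

text \<open>Class \<open>C\<^sup>k\<close>; meant for open \<open>S\<close> in a finite-dimensional space, where continuity of every
  \<open>x \<mapsto> D\<^sup>kf(x)[h\<^sub>1, \<dots>, h\<^sub>k]\<close> is the same as continuity of \<open>D\<^sup>kf\<close>.\<close>

definition C_k_on :: "nat \<Rightarrow> 'a::euclidean_space set \<Rightarrow> ('a \<Rightarrow> real) \<Rightarrow> bool" where
  "C_k_on k S f \<longleftrightarrow>
     (\<forall>hs. length hs < k \<longrightarrow> dir_deriv f hs differentiable_on S) \<and>
     (\<forall>hs. length hs = k \<longrightarrow> continuous_on S (dir_deriv f hs))"

definition grad :: "(real^'n \<Rightarrow> real) \<Rightarrow> real^'n \<Rightarrow> real^'n" where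
  "grad f x = (\<chi> i. dir_deriv f [axis i 1] x)"

definition hess :: "(real^'n \<Rightarrow> real) \<Rightarrow> real^'n \<Rightarrow> real^'n^'n" where
  "hess f x = (\<chi> i j. dir_deriv f [axis i 1, axis j 1] x)"

definition proper_cone :: "'a::euclidean_space set \<Rightarrow> bool" where
  "proper_cone K \<longleftrightarrow>
     cone K \<and> closed K \<and> convex K \<and> K \<inter> uminus ` K = {0} \<and> interior K \<noteq> {}"

definition dual_cone :: "'a::real_inner set \<Rightarrow> 'a set" where
  "dual_cone K = {s. \<forall>x\<in>K. 0 \<le> s \<bullet> x}"

text \<open>Functions on the interior of \<open>K\<close> are represented by total functions; no condition below
  depends on the values of \<open>F\<close> outside the open set \<open>interior K\<close>.\<close>

definition barrier_on :: "'a::euclidean_space set \<Rightarrow> ('a \<Rightarrow> real) \<Rightarrow> bool" where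
  "barrier_on K F \<longleftrightarrow>
     (\<forall>X l. (\<forall>k. X k \<in> interior K) \<and> X \<longlonglongrightarrow> l \<and> l \<in> frontier K \<longrightarrow>
        filterlim (\<lambda>k. F (X k)) at_top sequentially)"

definition LHSCB :: "real \<Rightarrow> 'a::euclidean_space set \<Rightarrow> ('a \<Rightarrow> real) \<Rightarrow> bool" where
  "LHSCB \<nu> K F \<longleftrightarrow>
     convex_on (interior K) F \<and>
     C_k_on 3 (interior K) F \<and>
     (\<forall>x\<in>interior K. \<forall>h.
        \<bar>dir_deriv F [h, h, h] x\<bar> \<le> 2 * dir_deriv F [h, h] x powr (3 / 2)) \<and>
     barrier_on K F \<and>
     (\<forall>x\<in>interior K. \<forall>t>0. F (t *\<^sub>R x) = F x - \<nu> * ln t)"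

definition dual_local_norm ::
    "(real^'n \<Rightarrow> real) \<Rightarrow> real^'n \<Rightarrow> real^'n \<Rightarrow> real" where
  "dual_local_norm F x v = sqrt (v \<bullet> (matrix_inv (hess F x) *v v))"

type_synonym ('n, 'm) point =
  "((real^'n) \<times> real) \<times> (real^'m) \<times> ((real^'n) \<times> real)"

definition conic_domain :: "(real^'n) set \<Rightarrow> ('n::finite, 'm::finite) point set" where
  "conic_domain K = (K \<times> {0..}) \<times> UNIV \<times> (dual_cone K \<times> {0..})"

definition mu :: "real \<Rightarrow> 'a::real_inner \<Rightarrow> 'a \<Rightarrow> real" where
  "mu \<nu> x s = (x \<bullet> s) / \<nu>"

definition psi ::
    "(real^'n \<Rightarrow> real) \<Rightarrow> real^'n \<Rightarrow> real^'n \<Rightarrow> real \<Rightarrow> real^'n" where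
  "psi F x s \<mu> = s + \<mu> *\<^sub>R grad F x"

definition nbhd ::
    "real \<Rightarrow> (real^'n) set \<Rightarrow> (real^'n \<Rightarrow> real) \<Rightarrow> real \<Rightarrow> real \<Rightarrow> real \<Rightarrow>
     ('n::finite, 'm::finite) point set" where
  "nbhd \<nu> K F \<eta> \<beta>\<^sub>l \<beta>\<^sub>u =
     {z \<in> interior (conic_domain K).
        case z of ((x, \<tau>), y, (s, \<kappa>)) \<Rightarrow>
          dual_local_norm F x (psi F x s (mu \<nu> x s)) \<le> \<eta> * mu \<nu> x s \<and>
          \<beta>\<^sub>l * mu \<nu> x s \<le> \<kappa> * \<tau> \<and> \<kappa> * \<tau> \<le> \<beta>\<^sub>u * mu \<nu> x s}"

definition outer_prod :: "real^'n \<Rightarrow> real^'n \<Rightarrow> real^'n^'n" where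
  "outer_prod u v = (columnvector u :: real^1^'n) ** (rowvector v :: real^'n^1)"

definition loewner_le :: "real^'n^'n \<Rightarrow> real^'n^'n \<Rightarrow> bool" (infix \<open>\<preceq>\<^sub>L\<close> 50) where
  "A \<preceq>\<^sub>L B \<longleftrightarrow>
     transpose A = A \<and> transpose B = B \<and> (\<forall>v. 0 \<le> v \<bullet> ((B - A) *v v))"

end

theory Submission
  imports Defs
begin

text \<open>With \<open>p = \<langle>\<psi>, v\<rangle>\<close> and \<open>q = \<langle>g, v\<rangle>\<close> one has \<open>\<langle>s, v\<rangle> = p - \<mu> q\<close>, so that
  \<open>\<langle>v, (W - H) v\<rangle> = (p\<^sup>2 - 2 \<mu> p q) / (\<nu> \<mu>\<^sup>2)\<close>. By Cauchy-Schwarz in the local norm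
  \<open>\<bar>p\<bar> \<le> \<eta> \<mu> \<parallel>v\<parallel>\<^sub>x\<close>, and \<open>\<bar>q\<bar> \<le> \<surd>\<nu> \<parallel>v\<parallel>\<^sub>x\<close> because logarithmic homogeneity gives \<open>H x = - g\<close>
  and \<open>\<langle>x, H x\<rangle> = \<nu>\<close>. Since \<open>\<nu> \<ge> 1\<close>, the quotient is at most \<open>(\<eta>\<^sup>2 + 2 \<eta>) \<parallel>v\<parallel>\<^sub>x\<^sup>2\<close>. The Hessian is
  positive definite: by self-concordance a degenerate direction stays degenerate along its whole
  line, so \<open>F\<close> would be affine there, and the barrier property would force the line into the
  pointed cone.\<close>

section \<open>Directional derivatives of C^k functions and their symmetry\<close>

declare dir_deriv.simps(2) [simp del]

lemma C_k_on_SucD: "C_k_on (Suc n) S f \<Longrightarrow> C_k_on n S f"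
  by (auto simp: C_k_on_def intro: differentiable_imp_continuous_on)

lemma C_k_on_mono: "C_k_on n S f \<Longrightarrow> m \<le> n \<Longrightarrow> C_k_on m S f"
  by (induction n) (auto simp: le_Suc_eq dest: C_k_on_SucD)

text \<open>On an open set \<open>differentiable_on\<close> means differentiability at the point, so
  \<open>frechet_derivative\<close> there is a true derivative and not an arbitrary choice.\<close>

lemma dir_deriv_has_derivative:
  assumes "C_k_on n S f" "open S" "x \<in> S" "length hs < n"
  shows "(dir_deriv f hs has_derivative (\<lambda>h. dir_deriv f (h # hs) x)) (at x)"
proof -
  have "dir_deriv f hs differentiable at x"
    using assms by (auto simp: C_k_on_def differentiable_on_eq_differentiable_at)
  then show ?thesis
    by (simp add: frechet_derivative_works dir_deriv.simps(2))
qed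

lemma linear_dir_deriv_Cons:
  assumes "C_k_on n S f" "open S" "x \<in> S" "length hs < n"
  shows "linear (\<lambda>h. dir_deriv f (h # hs) x)"
  using dir_deriv_has_derivative[OF assms] by (rule has_derivative_linear)

text \<open>Chain rule along a line, with linearity in the head direction pulling out the scalar.
  The later one-variable arguments along lines and rays rest on it.\<close>

lemma dir_deriv_has_real_derivative:
  assumes "C_k_on n S f" "open S" "x + t *\<^sub>R h \<in> S" "length hs < n"
  shows "((\<lambda>t. dir_deriv f hs (x + t *\<^sub>R h)) has_real_derivative
      dir_deriv f (h # hs) (x + t *\<^sub>R h)) (at t)"
proof -
  have "((\<lambda>t. x + t *\<^sub>R h) has_derivative (\<lambda>s. s *\<^sub>R h)) (at t)"
    by (auto intro!: derivative_eq_intros)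
  from has_derivative_compose[OF this dir_deriv_has_derivative[OF assms]]
  have "((\<lambda>t. dir_deriv f hs (x + t *\<^sub>R h)) has_derivative
      (\<lambda>s. dir_deriv f ((s *\<^sub>R h) # hs) (x + t *\<^sub>R h))) (at t)" .
  moreover have "dir_deriv f ((s *\<^sub>R h) # hs) (x + t *\<^sub>R h) =
      dir_deriv f (h # hs) (x + t *\<^sub>R h) * s" for s
    using linear_scale[OF linear_dir_deriv_Cons[OF assms]] by (simp add: mult.commute)
  ultimately show ?thesis
    by (simp add: has_field_derivative_def)
qed

text \<open>The mean value theorem is applied twice: in direction \<open>h\<close> to the difference
  \<open>u\<close>, then in direction \<open>k\<close> to \<open>dir_deriv f [h]\<close>. The second
  difference on the left is symmetric in \<open>h\<close> and \<open>k\<close>, which is what the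
  symmetry of second derivatives exploits.\<close>

lemma second_difference_mvt:
  assumes f: "C_k_on 2 S f" "open S" and "0 < t"
    and S: "\<And>a b. a \<in> {0..t} \<Longrightarrow> b \<in> {0..t} \<Longrightarrow> x + a *\<^sub>R h + b *\<^sub>R k \<in> S"
  shows "\<exists>a\<in>{0<..<t}. \<exists>b\<in>{0<..<t}.
    f (x + t *\<^sub>R h + t *\<^sub>R k) - f (x + t *\<^sub>R h) - f (x + t *\<^sub>R k) + f x =
    t\<^sup>2 * dir_deriv f [k, h] (x + a *\<^sub>R h + b *\<^sub>R k)"
proof -
  define u where "u a = f ((x + t *\<^sub>R k) + a *\<^sub>R h) - f (x + a *\<^sub>R h)" for a
  have "(u has_real_derivative dir_deriv f [h] ((x + t *\<^sub>R k) + a *\<^sub>R h)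
      - dir_deriv f [h] (x + a *\<^sub>R h)) (at a)" if "0 \<le> a" "a \<le> t" for a
    unfolding u_def
    using dir_deriv_has_real_derivative[OF f, of "x + t *\<^sub>R k" a h "[]"]
      dir_deriv_has_real_derivative[OF f, of x a h "[]"] S[of a t] S[of a 0] that \<open>0 < t\<close>
    by (intro DERIV_diff) (auto simp: algebra_simps)
  from MVT2[OF \<open>0 < t\<close> this] obtain a where a: "0 < a" "a < t"
    "u t - u 0 = t * (dir_deriv f [h] ((x + t *\<^sub>R k) + a *\<^sub>R h) - dir_deriv f [h] (x + a *\<^sub>R h))"
    by auto
  have "((\<lambda>b. dir_deriv f [h] ((x + a *\<^sub>R h) + b *\<^sub>R k)) has_real_derivative
      dir_deriv f [k, h] ((x + a *\<^sub>R h) + b *\<^sub>R k)) (at b)" if "0 \<le> b" "b \<le> t" for b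
    using dir_deriv_has_real_derivative[OF f, of "x + a *\<^sub>R h" b k "[h]"] S[of a b] a that
    by auto
  from MVT2[OF \<open>0 < t\<close> this] obtain b where b: "0 < b" "b < t"
    "dir_deriv f [h] ((x + a *\<^sub>R h) + t *\<^sub>R k) - dir_deriv f [h] (x + a *\<^sub>R h) =
      t * dir_deriv f [k, h] ((x + a *\<^sub>R h) + b *\<^sub>R k)"
    by auto
  have "u t - u 0 = t * (t * dir_deriv f [k, h] ((x + a *\<^sub>R h) + b *\<^sub>R k))"
    using a(3) b(3) by (simp add: algebra_simps)
  then show ?thesis
    using a(1,2) b(1,2)
    by (intro bexI[of _ a] bexI[of _ b]) (auto simp: u_def power2_eq_square algebra_simps)
qed

text \<open>Schwarz's theorem: the same second difference, evaluated in both orders, gives equal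
  mixed derivatives at two points near \<open>x\<close>, and continuity moves both to
  \<open>x\<close> itself.\<close>

lemma dir_deriv_swap:
  assumes f: "C_k_on 2 S f" and S: "open S" and x: "x \<in> S"
  shows "dir_deriv f [h, k] x = dir_deriv f [k, h] x"
proof -
  have cont: "isCont (dir_deriv f [h, k]) x" for h k
    using f S x by (auto simp: C_k_on_def continuous_on_eq_continuous_at)
  have "\<bar>dir_deriv f [h, k] x - dir_deriv f [k, h] x\<bar> \<le> e" if "0 < e" for e
  proof -
    have "\<exists>d>0. \<forall>y. dist y x < d \<longrightarrow> dist (dir_deriv f [h, k] y) (dir_deriv f [h, k] x) < e / 2" for h k
      using cont \<open>0 < e\<close> unfolding continuous_at_eps_delta by (meson half_gt_zero)
    then obtain d1 d2 where d12: "0 < d1" "0 < d2"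
      "\<And>y. dist y x < d1 \<Longrightarrow> \<bar>dir_deriv f [h, k] y - dir_deriv f [h, k] x\<bar> < e / 2"
      "\<And>y. dist y x < d2 \<Longrightarrow> \<bar>dir_deriv f [k, h] y - dir_deriv f [k, h] x\<bar> < e / 2"
      unfolding dist_real_def by meson
    obtain d3 where d3: "0 < d3" "ball x d3 \<subseteq> S"
      using S x open_contains_ball by blast
    define d where "d = min d1 (min d2 d3)"
    \<comment> \<open>This size keeps the parallelogram spanned by \<open>t *\<^sub>R h\<close> and
      \<open>t *\<^sub>R k\<close> within distance \<open>d / 2\<close> of \<open>x\<close>; the
      summand 1 keeps the denominator positive even for zero directions.\<close>
    define t where "t = d / (2 * (norm h + norm k + 1))"
    have "0 < d" using d12 d3 by (simp add: d_def)
    have pos: "0 < norm h + norm k + 1" by (simp add: add_nonneg_pos)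
    have "0 < t" using \<open>0 < d\<close> pos by (simp add: t_def)
    have near: "dist (x + a *\<^sub>R h + b *\<^sub>R k) x < d" if "a \<in> {0..t}" "b \<in> {0..t}" for a b
    proof -
      have "dist (x + a *\<^sub>R h + b *\<^sub>R k) x = norm (a *\<^sub>R h + b *\<^sub>R k)"
        by (simp add: dist_norm)
      also have "\<dots> \<le> a * norm h + b * norm k"
        using norm_triangle_ineq[of "a *\<^sub>R h" "b *\<^sub>R k"] that by simp
      also have "\<dots> \<le> t * norm h + t * norm k"
        using that by (intro add_mono mult_right_mono) auto
      also have "\<dots> \<le> t * (norm h + norm k + 1)"
        using \<open>0 < t\<close> by (simp add: algebra_simps)
      also have "\<dots> = d / 2" using pos by (simp add: t_def field_simps)
      finally show ?thesis using \<open>0 < d\<close> by simp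
    qed
    have inS: "x + a *\<^sub>R h + b *\<^sub>R k \<in> S" if "a \<in> {0..t}" "b \<in> {0..t}" for a b
      using near[OF that] d3 by (auto simp: d_def dist_commute subset_iff)
    have inS': "x + b *\<^sub>R k + a *\<^sub>R h \<in> S" if "b \<in> {0..t}" "a \<in> {0..t}" for a b
      using inS[OF that(2,1)] by (simp add: algebra_simps)
    obtain a b where ab: "a \<in> {0<..<t}" "b \<in> {0<..<t}"
      "f (x + t *\<^sub>R h + t *\<^sub>R k) - f (x + t *\<^sub>R h) - f (x + t *\<^sub>R k) + f x =
        t\<^sup>2 * dir_deriv f [k, h] (x + a *\<^sub>R h + b *\<^sub>R k)"
      using second_difference_mvt[OF f S \<open>0 < t\<close> inS] by blast
    obtain b' a' where ab': "b' \<in> {0<..<t}" "a' \<in> {0<..<t}"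
      "f (x + t *\<^sub>R k + t *\<^sub>R h) - f (x + t *\<^sub>R k) - f (x + t *\<^sub>R h) + f x =
        t\<^sup>2 * dir_deriv f [h, k] (x + b' *\<^sub>R k + a' *\<^sub>R h)"
      using second_difference_mvt[OF f S \<open>0 < t\<close> inS'] by blast
    have "t\<^sup>2 * dir_deriv f [k, h] (x + a *\<^sub>R h + b *\<^sub>R k) =
        t\<^sup>2 * dir_deriv f [h, k] (x + b' *\<^sub>R k + a' *\<^sub>R h)"
      using ab(3) ab'(3) by (simp add: algebra_simps)
    then have "dir_deriv f [k, h] (x + a *\<^sub>R h + b *\<^sub>R k) =
        dir_deriv f [h, k] (x + b' *\<^sub>R k + a' *\<^sub>R h)"
      using \<open>0 < t\<close> by simp
    moreover have "dist (x + a *\<^sub>R h + b *\<^sub>R k) x < d"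
      using ab by (intro near) auto
    moreover have "dist (x + b' *\<^sub>R k + a' *\<^sub>R h) x < d"
      using near[of a' b'] ab' by (simp add: algebra_simps)
    ultimately show ?thesis
      using d12(3)[of "x + b' *\<^sub>R k + a' *\<^sub>R h"] d12(4)[of "x + a *\<^sub>R h + b *\<^sub>R k"]
      by (simp add: d_def) argo
  qed
  then have "\<bar>dir_deriv f [h, k] x - dir_deriv f [k, h] x\<bar> \<le> 0"
    by (rule field_le_epsilon[of _ 0, simplified])
  then show ?thesis by simp
qed

section \<open>Gradient and Hessian as linear and bilinear forms\<close>

lemma linear_eq_sum_axis:
  fixes l :: "real^'n \<Rightarrow> real"
  assumes "linear l"
  shows "l v = (\<Sum>i\<in>UNIV. v $ i * l (axis i 1))"
proof -
  have "l v = l (\<Sum>i\<in>UNIV. (v $ i) *\<^sub>R axis i 1)"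
    using basis_expansion[of v] by (simp add: scalar_mult_eq_scaleR)
  also have "\<dots> = (\<Sum>i\<in>UNIV. v $ i * l (axis i 1))"
    by (simp add: linear_sum[OF assms] linear_scale[OF assms])
  finally show ?thesis .
qed

lemma grad_inner:
  assumes "C_k_on n S f" "open S" "x \<in> S" "0 < n"
  shows "grad f x \<bullet> v = dir_deriv f [v] x"
  using linear_eq_sum_axis[OF linear_dir_deriv_Cons[OF assms(1-3), of "[]"], of v] assms(4)
  by (simp add: grad_def inner_vec_def mult.commute)

text \<open>Linearity is directly available only in the head direction; symmetry transfers it to the
  second slot, so both slots can be expanded in the axes.\<close>

lemma hess_inner:
  assumes f: "C_k_on 2 S f" "open S" "x \<in> S"
  shows "v \<bullet> (hess f x *v w) = dir_deriv f [v, w] x"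
proof -
  have expand: "dir_deriv f [v, w] x = (\<Sum>i\<in>UNIV. v $ i * dir_deriv f [axis i 1, w] x)" for v w
    by (rule linear_eq_sum_axis[OF linear_dir_deriv_Cons[OF f]]) simp
  have "dir_deriv f [axis i 1, w] x = (\<Sum>j\<in>UNIV. w $ j * dir_deriv f [axis i 1, axis j 1] x)" for i
    using expand[of w "axis i 1"] by (simp only: dir_deriv_swap[OF f, of "axis i 1"])
  then have "dir_deriv f [v, w] x =
      (\<Sum>i\<in>UNIV. v $ i * (\<Sum>j\<in>UNIV. w $ j * dir_deriv f [axis i 1, axis j 1] x))"
    by (simp only: expand[of v w])
  also have "\<dots> = v \<bullet> (hess f x *v w)"
    by (simp add: hess_def inner_vec_def matrix_vector_mult_def mult.commute)
  finally show ?thesis ..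
qed

lemma transpose_hess:
  assumes "C_k_on 2 S f" "open S" "x \<in> S"
  shows "transpose (hess f x) = hess f x"
  using dir_deriv_swap[OF assms] by (simp add: hess_def transpose_def vec_eq_iff)

section \<open>First and second order consequences of convexity\<close>

text \<open>Restriction to the line through \<open>x\<close> in direction \<open>h\<close> reduces
  this to the tangent inequality for convex functions of one real variable.\<close>

lemma convex_on_imp_above_dir_deriv:
  assumes conv: "convex_on S f" and f: "C_k_on n S f" "0 < n" and S: "open S" and "x \<in> S" "x + h \<in> S"
  shows "f x + dir_deriv f [h] x \<le> f (x + h)"
proof -
  define T where "T = {t. x + t *\<^sub>R h \<in> S}"
  have "convex S" using conv by (rule convex_on_imp_convex)
  have comb: "x + ((1 - u) * a + u * b) *\<^sub>R h = (1 - u) *\<^sub>R (x + a *\<^sub>R h) + u *\<^sub>R (x + b *\<^sub>R h)"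
    for u a b :: real
    by (simp add: algebra_simps)
  have "open T"
  proof -
    have "open ((\<lambda>t. x + t *\<^sub>R h) -` S)"
      by (intro open_vimage S continuous_intros)
    then show ?thesis by (simp add: T_def vimage_def)
  qed
  have cT: "convex T"
    unfolding convex_alt
  proof (intro ballI allI impI)
    fix a b u :: real assume "a \<in> T" "b \<in> T" "0 \<le> u \<and> u \<le> 1"
    then show "(1 - u) *\<^sub>R a + u *\<^sub>R b \<in> T"
      using \<open>convex S\<close> comb[of u a b] by (simp add: T_def convex_alt)
  qed
  have "convex_on T (\<lambda>t. f (x + t *\<^sub>R h))"
  proof (rule convex_onI[OF _ cT])
    fix u a b :: real assume "0 < u" "u < 1" "a \<in> T" "b \<in> T"
    then show "f (x + ((1 - u) *\<^sub>R a + u *\<^sub>R b) *\<^sub>R h) \<le> (1 - u) * f (x + a *\<^sub>R h) + u * f (x + b *\<^sub>R h)"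
      using convex_onD[OF conv, of u "x + a *\<^sub>R h" "x + b *\<^sub>R h"] comb[of u a b] by (simp add: T_def)
  qed
  moreover have "0 \<in> interior T" "1 \<in> T"
    using assms \<open>open T\<close> by (auto simp: interior_open T_def)
  moreover have "((\<lambda>t. f (x + t *\<^sub>R h)) has_real_derivative dir_deriv f [h] x) (at 0 within T)"
    using dir_deriv_has_real_derivative[OF f(1) S, of x 0 h "[]"] assms
    by (auto intro: has_field_derivative_at_within)
  ultimately have "f (x + 1 *\<^sub>R h) - f (x + 0 *\<^sub>R h) \<ge> dir_deriv f [h] x * (1 - 0)"
    by (rule convex_on_imp_above_tangent[OF _ convex_connected[OF cT]])
  then show ?thesis by simp
qed

text \<open>Adding the tangent inequalities at two points of a line shows that the slope along the
  line is monotone, and a monotone function has nonnegative derivative.\<close>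

lemma convex_on_imp_dir_deriv2_nonneg:
  assumes conv: "convex_on S f" and f: "C_k_on 2 S f" and S: "open S" and x: "x \<in> S"
  shows "0 \<le> dir_deriv f [h, h] x"
proof -
  define T where "T = {t. x + t *\<^sub>R h \<in> S}"
  have "open ((\<lambda>t. x + t *\<^sub>R h) -` S)"
    by (intro open_vimage S continuous_intros)
  then have "open T" by (simp add: T_def vimage_def)
  have tangent: "f (x + a *\<^sub>R h) + (b - a) * dir_deriv f [h] (x + a *\<^sub>R h) \<le> f (x + b *\<^sub>R h)"
    if "a \<in> T" "b \<in> T" for a b
  proof -
    have "a *\<^sub>R h + (b - a) *\<^sub>R h = b *\<^sub>R h"
      by (simp add: algebra_simps)
    moreover have "dir_deriv f [(b - a) *\<^sub>R h] (x + a *\<^sub>R h) = (b - a) * dir_deriv f [h] (x + a *\<^sub>R h)"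
      using linear_scale[OF linear_dir_deriv_Cons[OF f S, of "x + a *\<^sub>R h" "[]"]] that
      by (simp add: T_def)
    ultimately show ?thesis
      using convex_on_imp_above_dir_deriv[OF conv f _ S, of "x + a *\<^sub>R h" "(b - a) *\<^sub>R h"] that
      by (simp add: T_def add.assoc)
  qed
  have "mono_on T (\<lambda>t. dir_deriv f [h] (x + t *\<^sub>R h))"
  proof (rule mono_onI)
    fix a b assume ab: "a \<in> T" "b \<in> T" "a \<le> b"
    have "(b - a) * (dir_deriv f [h] (x + b *\<^sub>R h) - dir_deriv f [h] (x + a *\<^sub>R h)) \<ge> 0"
      using tangent[of a b] tangent[of b a] ab by (simp add: algebra_simps)
    then show "dir_deriv f [h] (x + a *\<^sub>R h) \<le> dir_deriv f [h] (x + b *\<^sub>R h)"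
      using ab by (cases "a = b") (auto simp: zero_le_mult_iff)
  qed
  moreover have "((\<lambda>t. dir_deriv f [h] (x + t *\<^sub>R h)) has_real_derivative dir_deriv f [h, h] x) (at 0)"
    using dir_deriv_has_real_derivative[OF f S, of x 0 h "[h]"] x by simp
  moreover have "0 \<in> interior T"
    using x \<open>open T\<close> by (simp add: interior_open T_def)
  ultimately show ?thesis by (rule mono_on_imp_deriv_nonneg)
qed

section \<open>Geometry of proper cones and their duals\<close>

lemma proper_cone_pointed: "proper_cone K \<Longrightarrow> h \<in> K \<Longrightarrow> - h \<in> K \<Longrightarrow> h = 0"
  unfolding proper_cone_def by (metis IntI add.inverse_inverse imageI singletonD)

text \<open>A ball around 0 would contain a nonzero vector together with its negative, against
  pointedness.\<close>

lemma proper_cone_zero_notin_interior: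
  assumes "proper_cone (K :: 'a::euclidean_space set)"
  shows "0 \<notin> interior K"
proof
  assume "0 \<in> interior K"
  then obtain e where e: "0 < e" "ball 0 e \<subseteq> K"
    unfolding mem_interior by blast
  obtain b :: 'a where b: "b \<in> Basis" using nonempty_Basis by blast
  have "(e / 2) *\<^sub>R b \<in> K" "- ((e / 2) *\<^sub>R b) \<in> K"
    using e(1) b by (auto intro: subsetD[OF e(2)])
  then have "(e / 2) *\<^sub>R b = 0"
    by (rule proper_cone_pointed[OF assms])
  then show False using e b by auto
qed

lemma cone_interior_scaleR:
  fixes K :: "'a::real_normed_vector set"
  assumes "cone K" "x \<in> interior K" "0 < t"
  shows "t *\<^sub>R x \<in> interior K"
proof (rule interiorI)
  show "open ((*\<^sub>R) t ` interior K)"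
    using assms by (intro open_scaling) auto
  show "t *\<^sub>R x \<in> (*\<^sub>R) t ` interior K" using assms by simp
  show "(*\<^sub>R) t ` interior K \<subseteq> K"
    using assms interior_subset by (fastforce simp: cone_def)
qed

text \<open>Scaling the points of the ray back by \<open>1 / (n + 1)\<close> stays in the cone and
  converges to \<open>h\<close>.\<close>

lemma closed_cone_recession:
  fixes K :: "'a::real_normed_vector set"
  assumes "closed K" "cone K" and ray: "\<And>t. 0 \<le> t \<Longrightarrow> x + t *\<^sub>R h \<in> K"
  shows "h \<in> K"
proof (rule closed_sequentially[OF \<open>closed K\<close>])
  show "inverse (real (Suc n)) *\<^sub>R x + h \<in> K" for n
  proof -
    have "inverse (real (Suc n)) *\<^sub>R (x + real (Suc n) *\<^sub>R h) \<in> K"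
      using ray[of "real (Suc n)"] \<open>cone K\<close> by (auto simp: cone_def)
    then show ?thesis by (simp add: scaleR_add_right del: of_nat_Suc)
  qed
  have "(\<lambda>n. inverse (real (Suc n)) *\<^sub>R x + h) \<longlonglongrightarrow> 0 *\<^sub>R x + h"
    by (intro tendsto_intros LIMSEQ_inverse_real_of_nat)
  then show "(\<lambda>n. inverse (real (Suc n)) *\<^sub>R x + h) \<longlonglongrightarrow> h" by simp
qed

text \<open>An interior \<open>s\<close> stays in the dual cone after a small multiple of
  \<open>x\<close> is subtracted, which makes the inequality strict. This is the source of
  \<open>\<mu> > 0\<close>.\<close>

lemma inner_interior_dual_cone_pos:
  fixes K :: "'a::real_inner set"
  assumes "s \<in> interior (dual_cone K)" "x \<in> K" "x \<noteq> 0"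
  shows "0 < x \<bullet> s"
proof -
  obtain e where e: "0 < e" "ball s e \<subseteq> dual_cone K"
    using assms(1) unfolding mem_interior by blast
  define d where "d = e / (2 * norm x)"
  have "s - d *\<^sub>R x \<in> dual_cone K"
    using e assms(3) by (intro subsetD[OF e(2)]) (simp add: d_def dist_norm)
  then have "0 \<le> (s - d *\<^sub>R x) \<bullet> x" using assms(2) by (simp add: dual_cone_def)
  moreover have "0 < d * (x \<bullet> x)" using e assms(3) by (simp add: d_def)
  ultimately show ?thesis by (simp add: inner_diff_left inner_commute[of x s])
qed

section \<open>Logarithmic homogeneity and the barrier parameter\<close>

lemma LHSCB_D:
  assumes "LHSCB \<nu> K F"
  shows "convex_on (interior K) F" "C_k_on 3 (interior K) F" "C_k_on 2 (interior K) F" "barrier_on K F"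
    and "\<And>x h. x \<in> interior K \<Longrightarrow> \<bar>dir_deriv F [h, h, h] x\<bar> \<le> 2 * dir_deriv F [h, h] x powr (3 / 2)"
    and "\<And>x t. x \<in> interior K \<Longrightarrow> 0 < t \<Longrightarrow> F (t *\<^sub>R x) = F x - \<nu> * ln t"
  using assms C_k_on_mono[of 3 "interior K" F 2] unfolding LHSCB_def by simp_all

text \<open>A limit of interior points that is not interior lies on the frontier. The contradiction
  is drawn twice: at the apex of the cone and at the end of a degenerate segment.\<close>

lemma barrier_on_not_bounded:
  assumes "barrier_on K F" "\<And>k. X k \<in> interior K" "X \<longlonglongrightarrow> l" "l \<notin> interior K"
  shows "\<not> (\<forall>k. F (X k) \<le> B)"
proof
  assume B: "\<forall>k. F (X k) \<le> B"
  have "l \<in> closure K"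
    using assms(2,3) closure_sequential interior_subset by blast
  then have "l \<in> frontier K" using assms(4) by (simp add: frontier_def)
  then have "filterlim (\<lambda>k. F (X k)) at_top sequentially"
    using assms by (auto simp: barrier_on_def)
  then have "eventually (\<lambda>k. B < F (X k)) sequentially"
    by (auto simp: filterlim_at_top_dense)
  then obtain k where "B < F (X k)"
    by (auto simp: eventually_sequentially)
  with B show False by (simp add: not_le[symmetric])
qed

text \<open>The barrier blows up at the apex of the cone along a ray, where it equals \<open>-\<nu> ln t\<close> up to a constant.\<close>

lemma LHSCB_parameter_pos:
  assumes K: "proper_cone K" and L: "LHSCB \<nu> K F" and x: "x \<in> interior K"
  shows "0 < \<nu>"
proof (rule ccontr)
  assume "\<not> 0 < \<nu>"
  define X where "X k = inverse (real (Suc k)) *\<^sub>R x" for k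
  have "X \<longlonglongrightarrow> 0 *\<^sub>R x"
    unfolding X_def by (intro tendsto_intros LIMSEQ_inverse_real_of_nat)
  then have lim: "X \<longlonglongrightarrow> 0" by simp
  have "X k \<in> interior K" for k
    using cone_interior_scaleR[OF _ x, of "inverse (real (Suc k))"] K
    by (simp add: X_def proper_cone_def)
  moreover have "F (X k) \<le> F x" for k
  proof -
    have "F (X k) = F x + \<nu> * ln (real (Suc k))"
      using LHSCB_D(6)[OF L x, of "inverse (real (Suc k))"]
      by (simp add: X_def ln_inverse del: of_nat_Suc)
    also have "\<dots> \<le> F x"
      using \<open>\<not> 0 < \<nu>\<close> by (simp add: mult_nonpos_nonneg)
    finally show ?thesis .
  qed
  ultimately show False
    using barrier_on_not_bounded[OF LHSCB_D(4)[OF L] _ lim proper_cone_zero_notin_interior[OF K]] by blast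
qed

text \<open>Differentiating \<open>F (t *\<^sub>R y) = F y - \<nu> * ln t\<close> in
  \<open>y\<close> leaves the derivative of \<open>F\<close> on the right, while the chain rule
  produces a factor \<open>t\<close> on the left.\<close>

lemma LHSCB_dir_deriv_scaleR:
  assumes K: "proper_cone K" and L: "LHSCB \<nu> K F" and x: "x \<in> interior K" and t: "0 < t"
  shows "dir_deriv F [h] (t *\<^sub>R x) = dir_deriv F [h] x / t"
proof -
  have tx: "t *\<^sub>R x \<in> interior K"
    using cone_interior_scaleR[OF _ x t] K by (simp add: proper_cone_def)
  note der = dir_deriv_has_derivative[OF LHSCB_D(3)[OF L] open_interior, of _ "[]", simplified]
  have "((\<lambda>y. t *\<^sub>R y) has_derivative (\<lambda>h. t *\<^sub>R h)) (at x)"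
    by (auto intro!: derivative_eq_intros)
  from has_derivative_compose[OF this der[OF tx]]
  have "((\<lambda>y. F (t *\<^sub>R y)) has_derivative (\<lambda>h. dir_deriv F [t *\<^sub>R h] (t *\<^sub>R x))) (at x)" .
  moreover have "((\<lambda>y. F (t *\<^sub>R y)) has_derivative (\<lambda>h. dir_deriv F [h] x)) (at x)"
  proof (rule has_derivative_transform_within_open[OF _ open_interior x])
    show "((\<lambda>y. F y - \<nu> * ln t) has_derivative (\<lambda>h. dir_deriv F [h] x)) (at x)"
      using has_derivative_diff[OF der[OF x] has_derivative_const] by simp
  qed (use LHSCB_D(6)[OF L] t in simp)
  ultimately have "dir_deriv F [t *\<^sub>R h] (t *\<^sub>R x) = dir_deriv F [h] x"
    using has_derivative_unique by metis
  moreover have "dir_deriv F [t *\<^sub>R h] (t *\<^sub>R x) = t * dir_deriv F [h] (t *\<^sub>R x)"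
    using linear_scale[OF linear_dir_deriv_Cons[OF LHSCB_D(3)[OF L] open_interior tx, of "[]"]] by simp
  ultimately show ?thesis using t by (simp add: field_simps)
qed

lemma DERIV_eq_on_open:
  assumes "(f has_real_derivative f') (at t)" "(g has_real_derivative g') (at t)"
    "open S" "t \<in> S" "\<And>t. t \<in> S \<Longrightarrow> f t = g t"
  shows "f' = g'"
  by (rule DERIV_unique[OF has_field_derivative_transform_within_open[OF assms(1,3,4,5)] assms(2)])

text \<open>The ray is treated as the line from base point 0 in direction \<open>x\<close>; only the
  current point \<open>t *\<^sub>R x\<close> has to be interior.\<close>

lemma LHSCB_dir_deriv_ray:
  assumes K: "proper_cone K" and L: "LHSCB \<nu> K F" and x: "x \<in> interior K" and t: "0 < t" and "length hs < 3"
  shows "((\<lambda>t. dir_deriv F hs (t *\<^sub>R x)) has_real_derivative dir_deriv F (x # hs) (t *\<^sub>R x)) (at t)"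
  using dir_deriv_has_real_derivative[OF LHSCB_D(2)[OF L] open_interior, of 0 t x hs]
    cone_interior_scaleR[OF _ x t] K assms(5) by (simp add: proper_cone_def)

lemma LHSCB_dir_deriv_self:
  assumes K: "proper_cone K" and L: "LHSCB \<nu> K F" and x: "x \<in> interior K"
  shows "dir_deriv F [x] x = - \<nu>"
proof -
  have "((\<lambda>t. F (t *\<^sub>R x)) has_real_derivative dir_deriv F [x] x) (at 1)"
    using LHSCB_dir_deriv_ray[OF K L x, of 1 "[]"] by simp
  moreover have "((\<lambda>t. F x - \<nu> * ln t) has_real_derivative - \<nu>) (at 1)"
    by (auto intro!: derivative_eq_intros)
  ultimately show ?thesis
    by (rule DERIV_eq_on_open[of _ _ _ _ _ "{0<..}"]) (use LHSCB_D(6)[OF L x] in auto)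
qed

text \<open>The scaling law of the gradient differentiated at \<open>t = 1\<close>; in matrix form
  this is \<open>H x = - g\<close>.\<close>

lemma LHSCB_dir_deriv2_self:
  assumes K: "proper_cone K" and L: "LHSCB \<nu> K F" and x: "x \<in> interior K"
  shows "dir_deriv F [x, h] x = - dir_deriv F [h] x"
proof -
  have "((\<lambda>t. dir_deriv F [h] (t *\<^sub>R x)) has_real_derivative dir_deriv F [x, h] x) (at 1)"
    using LHSCB_dir_deriv_ray[OF K L x, of 1 "[h]"] by simp
  moreover have "((\<lambda>t. dir_deriv F [h] x / t) has_real_derivative - dir_deriv F [h] x) (at 1)"
    by (auto intro!: derivative_eq_intros)
  ultimately show ?thesis
    by (rule DERIV_eq_on_open[of _ _ _ _ _ "{0<..}"]) (use LHSCB_dir_deriv_scaleR[OF K L x] in auto)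
qed

lemma LHSCB_dir_deriv3_self:
  assumes K: "proper_cone K" and L: "LHSCB \<nu> K F" and x: "x \<in> interior K"
  shows "dir_deriv F [x, x, x] x = - 2 * \<nu>"
proof -
  \<comment> \<open>The formula is needed on the whole ray, not only at \<open>t = 1\<close>,
    because it is differentiated once more.\<close>
  have second: "dir_deriv F [x, x] (t *\<^sub>R x) = \<nu> / t\<^sup>2" if "0 < t" for t
  proof -
    have "((\<lambda>t. dir_deriv F [x] (t *\<^sub>R x)) has_real_derivative dir_deriv F [x, x] (t *\<^sub>R x)) (at t)"
      using LHSCB_dir_deriv_ray[OF K L x that, of "[x]"] by simp
    moreover have "((\<lambda>t. - \<nu> / t) has_real_derivative \<nu> / t\<^sup>2) (at t)"
      using that by (auto intro!: derivative_eq_intros simp: power2_eq_square)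
    ultimately show ?thesis
      by (rule DERIV_eq_on_open[of _ _ _ _ _ "{0<..}"])
        (use that LHSCB_dir_deriv_scaleR[OF K L x] LHSCB_dir_deriv_self[OF K L x] in auto)
  qed
  have "((\<lambda>t. dir_deriv F [x, x] (t *\<^sub>R x)) has_real_derivative dir_deriv F [x, x, x] x) (at 1)"
    using LHSCB_dir_deriv_ray[OF K L x, of 1 "[x, x]"] by simp
  moreover have "((\<lambda>t. \<nu> / t\<^sup>2) has_real_derivative - 2 * \<nu>) (at 1)"
    by (auto intro!: derivative_eq_intros)
  ultimately show ?thesis
    by (rule DERIV_eq_on_open[of _ _ _ _ _ "{0<..}"]) (use second in auto)
qed

text \<open>Self-concordance in the direction of \<open>x\<close> itself reads \<open>2 \<nu> \<le> 2 \<nu>\<^bsup>3/2\<^esup>\<close>.\<close>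

lemma LHSCB_parameter_ge_1:
  assumes K: "proper_cone K" and L: "LHSCB \<nu> K F" and x: "x \<in> interior K"
  shows "1 \<le> \<nu>"
proof -
  have "0 < \<nu>" by (rule LHSCB_parameter_pos[OF K L x])
  have "2 * \<nu> \<le> 2 * \<nu> powr (3 / 2)"
    using LHSCB_D(5)[OF L x, of x] LHSCB_dir_deriv3_self[OF K L x] LHSCB_dir_deriv2_self[OF K L x, of x]
      LHSCB_dir_deriv_self[OF K L x] \<open>0 < \<nu>\<close> by simp
  then have "\<nu> powr 1 \<le> \<nu> powr (3 / 2)"
    using \<open>0 < \<nu>\<close> by simp
  \<comment> \<open>For \<open>\<nu> < 1\<close> powers of \<nu> would strictly decrease in the
    exponent.\<close>
  then show ?thesis
    using \<open>0 < \<nu>\<close> powr_less_mono'[of \<nu> 1 "3 / 2"] by linarith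
qed

section \<open>Nondegeneracy of the Hessian\<close>

text \<open>On a compact interval \<open>u\<close> is bounded, so \<open>u' \<le> c u\<close> for a constant \<open>c\<close>, and \<open>u\<close> stays zero by Gronwall.\<close>

lemma powr_three_halves_ode_zero:
  fixes u u' :: "real \<Rightarrow> real"
  assumes "0 \<le> T"
    and der: "\<And>t. 0 \<le> t \<Longrightarrow> t \<le> T \<Longrightarrow> (u has_real_derivative u' t) (at t)"
    and nonneg: "\<And>t. 0 \<le> t \<Longrightarrow> t \<le> T \<Longrightarrow> 0 \<le> u t"
    and bound: "\<And>t. 0 \<le> t \<Longrightarrow> t \<le> T \<Longrightarrow> \<bar>u' t\<bar> \<le> 2 * u t powr (3 / 2)"
    and "u 0 = 0"
  shows "u T = 0"
proof -
  have "continuous_on {0..T} u"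
    by (intro continuous_at_imp_continuous_on ballI DERIV_isCont[OF der]) auto
  then have "bounded (u ` {0..T})"
    by (intro compact_imp_bounded compact_continuous_image) auto
  then obtain M where "\<forall>r\<in>u ` {0..T}. norm r \<le> M"
    unfolding bounded_iff by blast
  then have M: "u t \<le> M" if "0 \<le> t" "t \<le> T" for t
    using that by (auto simp: abs_le_iff)
  \<comment> \<open>The constant comes from \<open>2 * u powr (3 / 2) = 2 * u * sqrt u\<close>,
    which is at most \<open>2 * sqrt M * u\<close>; the integrating factor
    \<open>exp (- c * t)\<close> then makes \<open>u\<close> nonincreasing.\<close>
  define c where "c = 2 * sqrt M"
  have le: "u' t \<le> c * u t" if "0 \<le> t" "t \<le> T" for t
  proof -
    have "u t powr (3 / 2) = u t * sqrt (u t)"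
      using nonneg[OF that] powr_add[of "u t" 1 "1 / 2"] by (simp add: powr_half_sqrt)
    also have "\<dots> \<le> u t * sqrt M"
      using nonneg[OF that] M[OF that] by (intro mult_left_mono) auto
    finally show ?thesis
      using bound[OF that] by (simp add: c_def algebra_simps)
  qed
  have "u T * exp (- c * T) \<le> u 0 * exp (- c * 0)"
  proof (rule DERIV_nonpos_imp_nonincreasing[OF \<open>0 \<le> T\<close>])
    fix t assume t: "0 \<le> t" "t \<le> T"
    have "((\<lambda>t. u t * exp (- c * t)) has_real_derivative (u' t - c * u t) * exp (- c * t)) (at t)"
      using der[OF t] by (auto intro!: derivative_eq_intros simp: algebra_simps)
    moreover have "(u' t - c * u t) * exp (- c * t) \<le> 0"
      using le[OF t] by (simp add: mult_nonpos_nonneg)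
    ultimately show "\<exists>y. ((\<lambda>t. u t * exp (- c * t)) has_real_derivative y) (at t) \<and> y \<le> 0"
      by blast
  qed
  then have "u T \<le> 0" using \<open>u 0 = 0\<close> by (simp add: mult_le_0_iff)
  then show ?thesis using nonneg[of T] \<open>0 \<le> T\<close> by simp
qed

text \<open>Self-concordance is the differential inequality of the preceding lemma for the second
  derivative along the segment. Hence that derivative stays zero, the slope is constant and
  \<open>F\<close> is affine.\<close>

lemma LHSCB_affine_on_degenerate_segment:
  assumes L: "LHSCB \<nu> K F" and "0 \<le> T"
    and seg: "\<And>t. 0 \<le> t \<Longrightarrow> t \<le> T \<Longrightarrow> x + t *\<^sub>R h \<in> interior K"
    and zero: "dir_deriv F [h, h] x = 0"
  shows "F (x + T *\<^sub>R h) = F x + T * dir_deriv F [h] x"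
proof -
  note der = dir_deriv_has_real_derivative[OF LHSCB_D(2)[OF L] open_interior seg]
  have d2: "dir_deriv F [h, h] (x + t *\<^sub>R h) = 0" if t: "0 \<le> t" "t \<le> T" for t
  proof (rule powr_three_halves_ode_zero[where u = "\<lambda>t. dir_deriv F [h, h] (x + t *\<^sub>R h)"
        and u' = "\<lambda>t. dir_deriv F [h, h, h] (x + t *\<^sub>R h)", OF t(1)])
    fix r assume r: "0 \<le> r" "r \<le> t"
    then have r': "0 \<le> r" "r \<le> T" using t by auto
    show "((\<lambda>t. dir_deriv F [h, h] (x + t *\<^sub>R h)) has_real_derivative
        dir_deriv F [h, h, h] (x + r *\<^sub>R h)) (at r)"
      using der[OF r', of "[h, h]"] by simp
    show "0 \<le> dir_deriv F [h, h] (x + r *\<^sub>R h)"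
      using convex_on_imp_dir_deriv2_nonneg[OF LHSCB_D(1,3)[OF L] open_interior seg[OF r']] .
    show "\<bar>dir_deriv F [h, h, h] (x + r *\<^sub>R h)\<bar> \<le> 2 * dir_deriv F [h, h] (x + r *\<^sub>R h) powr (3 / 2)"
      using LHSCB_D(5)[OF L seg[OF r']] .
  qed (simp add: zero)
  have const: "f T = f 0" if "\<And>t. 0 \<le> t \<Longrightarrow> t \<le> T \<Longrightarrow> (f has_real_derivative 0) (at t)" "0 \<le> T" for f T
    using DERIV_nonpos_imp_nonincreasing[of 0 T f] DERIV_nonneg_imp_nondecreasing[of 0 T f] that
    by (metis antisym order_refl)
  have d1: "dir_deriv F [h] (x + t *\<^sub>R h) = dir_deriv F [h] x" if t: "0 \<le> t" "t \<le> T" for t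
    using const[of t "\<lambda>t. dir_deriv F [h] (x + t *\<^sub>R h)"] der[of _ "[h]"] d2 t by force
  have "((\<lambda>t. F (x + t *\<^sub>R h) - t * dir_deriv F [h] x) has_real_derivative 0) (at t)"
    if t: "0 \<le> t" "t \<le> T" for t
    using der[OF t, of "[]"] d1[OF t] by (auto intro!: derivative_eq_intros)
  from const[OF this \<open>0 \<le> T\<close>] show ?thesis by simp
qed

text \<open>Up to a first exit from the interior \<open>F\<close> is affine on the ray, hence
  bounded there, whereas the barrier property forces it to blow up at the exit point.\<close>

lemma LHSCB_degenerate_ray:
  assumes L: "LHSCB \<nu> K F" and x: "x \<in> interior K" and zero: "dir_deriv F [h, h] x = 0" and "0 \<le> t"
  shows "x + t *\<^sub>R h \<in> interior K"
proof (rule ccontr)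
  assume out: "x + t *\<^sub>R h \<notin> interior K"
  define C where "C = {0..} \<inter> (\<lambda>t. x + t *\<^sub>R h) -` (- interior K)"
  \<comment> \<open>The first exit parameter; it belongs to \<open>C\<close> because
    \<open>C\<close> is closed.\<close>
  define T where "T = Inf C"
  have "closed C"
    unfolding C_def by (intro closed_Int closed_atLeast closed_vimage continuous_intros) auto
  moreover have "C \<noteq> {}" "bdd_below C"
    using out \<open>0 \<le> t\<close> by (auto simp: C_def intro!: bdd_belowI[of _ 0])
  ultimately have "T \<in> C" unfolding T_def by (intro closed_contains_Inf)
  have inside: "x + r *\<^sub>R h \<in> interior K" if "0 \<le> r" "r < T" for r
  proof (rule ccontr)
    assume "x + r *\<^sub>R h \<notin> interior K"
    then have "r \<in> C" using that(1) by (simp add: C_def)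
    from cInf_lower[OF this \<open>bdd_below C\<close>] that(2) show False by (simp add: T_def)
  qed
  have "T \<noteq> 0" using \<open>T \<in> C\<close> x by (auto simp: C_def)
  with \<open>T \<in> C\<close> have "0 < T" by (simp add: C_def)
  \<comment> \<open>These parameters converge to \<open>T\<close> from below and start at 0, so the
    corresponding points are interior.\<close>
  define r where "r k = T * (1 - inverse (real (Suc k)))" for k
  have r: "0 \<le> r k" "r k < T" for k
    using \<open>0 < T\<close> by (auto simp: r_def field_simps)
  define X where "X k = x + r k *\<^sub>R h" for k
  have "X \<longlonglongrightarrow> x + (T * (1 - 0)) *\<^sub>R h"
    unfolding X_def r_def by (intro tendsto_intros LIMSEQ_inverse_real_of_nat)
  then have lim: "X \<longlonglongrightarrow> x + T *\<^sub>R h" by simp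
  have "F (X k) \<le> F x + T * \<bar>dir_deriv F [h] x\<bar>" for k
  proof -
    have "F (X k) = F x + r k * dir_deriv F [h] x"
      unfolding X_def
      by (rule LHSCB_affine_on_degenerate_segment[OF L r(1) inside zero]) (use r(2)[of k] in auto)
    also have "\<dots> \<le> F x + r k * \<bar>dir_deriv F [h] x\<bar>"
      using r(1)[of k] by (simp add: mult_left_mono)
    also have "\<dots> \<le> F x + T * \<bar>dir_deriv F [h] x\<bar>"
      using r(2)[of k] by (simp add: mult_right_mono)
    finally show ?thesis .
  qed
  moreover have "X k \<in> interior K" for k
    using inside[OF r] by (simp add: X_def)
  ultimately show False
    using barrier_on_not_bounded[OF LHSCB_D(4)[OF L] _ lim] \<open>T \<in> C\<close> by (auto simp: C_def)
qed

text \<open>If \<open>h\<close> is degenerate then so is \<open>- h\<close>; both rays stay in the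
  cone, so both directions belong to it, contradicting pointedness.\<close>

lemma LHSCB_dir_deriv2_pos:
  assumes K: "proper_cone K" and L: "LHSCB \<nu> K F" and x: "x \<in> interior K" and "h \<noteq> 0"
  shows "0 < dir_deriv F [h, h] x"
proof (rule ccontr)
  assume "\<not> 0 < dir_deriv F [h, h] x"
  then have zero: "dir_deriv F [h, h] x = 0"
    using convex_on_imp_dir_deriv2_nonneg[OF LHSCB_D(1,3)[OF L] open_interior x, of h] by linarith
  have neg: "dir_deriv F [- h, k] x = - dir_deriv F [h, k] x" for k
    using linear_neg[OF linear_dir_deriv_Cons[OF LHSCB_D(3)[OF L] open_interior x, of "[k]"]] by simp
  have zero': "dir_deriv F [- h, - h] x = 0"
    using neg dir_deriv_swap[OF LHSCB_D(3)[OF L] open_interior x, of h "- h"] zero by simp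
  have "h \<in> K" if "dir_deriv F [h, h] x = 0" for h
  proof (rule closed_cone_recession[of K x])
    show "x + t *\<^sub>R h \<in> K" if "0 \<le> t" for t
      using LHSCB_degenerate_ray[OF L x \<open>dir_deriv F [h, h] x = 0\<close> that] interior_subset by blast
  qed (use K in \<open>auto simp: proper_cone_def\<close>)
  from this[OF zero] this[OF zero'] \<open>h \<noteq> 0\<close> show False
    using proper_cone_pointed[OF K] by blast
qed

section \<open>Positive definite matrices and the scalar estimate\<close>

lemma inner_symmetric_matrix:
  fixes A :: "real^'n^'n"
  assumes "transpose A = A"
  shows "a \<bullet> (A *v b) = b \<bullet> (A *v a)"
  using assms by (metis dot_lmul_matrix inner_commute transpose_matrix_vector)

lemma positive_definite_Cauchy_Schwarz:
  fixes A :: "real^'n^'n"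
  assumes sym: "transpose A = A" and pos: "\<And>v. v \<noteq> 0 \<Longrightarrow> 0 < v \<bullet> (A *v v)"
  shows "(a \<bullet> (A *v b))\<^sup>2 \<le> (a \<bullet> (A *v a)) * (b \<bullet> (A *v b))"
proof (cases "b = 0")
  case False
  \<comment> \<open>This \<open>c\<close> minimises the quadratic form at
    \<open>a - c *\<^sub>R b\<close>.\<close>
  define c where "c = (a \<bullet> (A *v b)) / (b \<bullet> (A *v b))"
  have b: "0 < b \<bullet> (A *v b)" using pos False by blast
  have "0 \<le> (a - c *\<^sub>R b) \<bullet> (A *v (a - c *\<^sub>R b))"
    using pos[of "a - c *\<^sub>R b"] by (cases "a - c *\<^sub>R b = 0") auto
  also have "\<dots> = a \<bullet> (A *v a) - 2 * c * (a \<bullet> (A *v b)) + c\<^sup>2 * (b \<bullet> (A *v b))"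
    using inner_symmetric_matrix[OF sym, of b a]
    by (simp add: matrix_vector_mult_diff_distrib matrix_vector_mult_scaleR inner_diff_left
        inner_diff_right power2_eq_square algebra_simps)
  also have "\<dots> = a \<bullet> (A *v a) - (a \<bullet> (A *v b))\<^sup>2 / (b \<bullet> (A *v b))"
    using b by (simp add: c_def power2_eq_square field_simps)
  finally show ?thesis using b by (simp add: field_simps)
qed simp

text \<open>\<open>matrix_inv\<close> is a choice operator, so invertibility must come first;
  positive definiteness supplies it through a trivial kernel.\<close>

lemma positive_definite_matrix_inv:
  fixes A :: "real^'n^'n"
  assumes "\<And>v. v \<noteq> 0 \<Longrightarrow> 0 < v \<bullet> (A *v v)"
  shows "A *v (matrix_inv A *v b) = b"
proof -
  have "\<forall>v. A *v v = 0 \<longrightarrow> v = 0"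
    using assms by (metis inner_zero_right less_irrefl)
  then have "invertible A"
    by (simp add: invertible_left_inverse matrix_left_invertible_ker)
  then have "A ** matrix_inv A = mat 1"
    unfolding invertible_def matrix_inv_def by (rule someI2_ex) simp
  then show ?thesis by (simp add: matrix_vector_mul_assoc)
qed

lemma outer_prod_vector_mult: "outer_prod u w *v v = (w \<bullet> v) *\<^sub>R u"
  by (simp add: outer_prod_def vec_eq_iff matrix_vector_mult_def matrix_matrix_mult_def
      columnvector_def rowvector_def inner_vec_def sum_distrib_left sum_distrib_right mult_ac)

text \<open>With \<open>a = p / \<mu>\<close> the two \<open>q\<^sup>2\<close> terms cancel and
  \<open>(a\<^sup>2 - 2 * a * q) / \<nu>\<close> remains. The factor \<open>sqrt \<nu>\<close> from
  the bound on \<open>q\<close> is absorbed by the division by \<nu>.\<close>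

lemma rank_two_update_bound:
  fixes p q N \<eta> \<mu> \<nu> :: real
  assumes "1 \<le> \<nu>" "0 < \<mu>" "0 \<le> \<eta>" "0 \<le> N"
    and p: "\<bar>p\<bar> \<le> \<eta> * \<mu> * sqrt N" and q: "\<bar>q\<bar> \<le> sqrt \<nu> * sqrt N"
  shows "\<bar>(p - \<mu> * q)\<^sup>2 / (\<nu> * \<mu>\<^sup>2) - q\<^sup>2 / \<nu>\<bar> \<le> (\<eta>\<^sup>2 + 2 * \<eta>) * N"
proof -
  define a where "a = p / \<mu>"
  have a: "\<bar>a\<bar> \<le> \<eta> * sqrt N"
    using p \<open>0 < \<mu>\<close> by (simp add: a_def field_simps)
  have "(p - \<mu> * q)\<^sup>2 / (\<nu> * \<mu>\<^sup>2) - q\<^sup>2 / \<nu> = (a\<^sup>2 - 2 * a * q) / \<nu>"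
    using assms(1,2) by (simp add: a_def field_simps power2_eq_square)
  moreover have "\<bar>a\<^sup>2 - 2 * a * q\<bar> \<le> \<nu> * ((\<eta>\<^sup>2 + 2 * \<eta>) * N)"
  proof -
    have "\<bar>a\<^sup>2 - 2 * a * q\<bar> \<le> \<bar>a\<bar> * \<bar>a\<bar> + 2 * (\<bar>a\<bar> * \<bar>q\<bar>)"
      using abs_triangle_ineq4[of "a\<^sup>2" "2 * a * q"] by (simp add: abs_mult power2_eq_square)
    also have "\<dots> \<le> (\<eta> * sqrt N) * (\<eta> * sqrt N) + 2 * ((\<eta> * sqrt N) * (sqrt \<nu> * sqrt N))"
      using a q assms(3,4) by (intro add_mono mult_mono mult_left_mono) auto
    also have "\<dots> = \<eta>\<^sup>2 * (sqrt N)\<^sup>2 + 2 * \<eta> * (sqrt N)\<^sup>2 * sqrt \<nu>"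
      by (simp only: power2_eq_square mult_ac)
    also have "\<dots> = \<eta>\<^sup>2 * N + 2 * \<eta> * N * sqrt \<nu>"
      using assms(4) by simp
    also have "\<dots> \<le> \<eta>\<^sup>2 * N * \<nu> + 2 * \<eta> * N * \<nu>"
    proof (rule add_mono)
      have "sqrt \<nu> \<le> \<nu>"
        using assms(1) by (intro real_le_lsqrt) (auto simp: power2_eq_square)
      then show "2 * \<eta> * N * sqrt \<nu> \<le> 2 * \<eta> * N * \<nu>"
        using assms by (intro mult_left_mono) auto
      show "\<eta>\<^sup>2 * N \<le> \<eta>\<^sup>2 * N * \<nu>"
        using mult_left_mono[of 1 \<nu> "\<eta>\<^sup>2 * N"] assms(1,4) by simp
    qed
    finally show ?thesis by (simp add: algebra_simps)
  qed
  ultimately show ?thesis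
    using assms(1) by (simp add: abs_divide field_simps)
qed

theorem theorem3p2:
  fixes K :: "(real^'n::finite) set" and F :: "real^'n \<Rightarrow> real"
    and \<nu> \<eta> \<beta>\<^sub>l \<beta>\<^sub>u :: real
    and x s :: "real^'n" and \<tau> \<kappa> :: real and y :: "real^'m::finite"
  assumes "proper_cone K"
    and "LHSCB \<nu> K F"
    and "0 < \<beta>\<^sub>l" and "\<beta>\<^sub>l \<le> \<beta>\<^sub>u"
    and "0 < \<eta>" and "\<eta> < sqrt 2 - 1"
    and "((x, \<tau>), y, (s, \<kappa>)) \<in> nbhd \<nu> K F \<eta> \<beta>\<^sub>l \<beta>\<^sub>u"
  shows "let \<mu> = mu \<nu> x s; g = grad F x; H = hess F x;
             W = H + (1 / (\<nu> * \<mu>\<^sup>2)) *\<^sub>R outer_prod s s - (1 / \<nu>) *\<^sub>R outer_prod g g;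
             \<delta> = \<eta>\<^sup>2 + 2 * \<eta>
         in \<delta> < 1 \<and> (1 - \<delta>) *\<^sub>R H \<preceq>\<^sub>L W \<and> W \<preceq>\<^sub>L (1 + \<delta>) *\<^sub>R H"
proof -
  note K = assms(1) and L = assms(2)
  note C2 = LHSCB_D(3)[OF L]
  define \<mu> g H where "\<mu> = mu \<nu> x s" and "g = grad F x" and "H = hess F x"
  define W where "W = H + (1 / (\<nu> * \<mu>\<^sup>2)) *\<^sub>R outer_prod s s - (1 / \<nu>) *\<^sub>R outer_prod g g"
  define \<psi> where "\<psi> = psi F x s \<mu>"
  define \<delta> where "\<delta> = \<eta>\<^sup>2 + 2 * \<eta>"
  have x: "x \<in> interior K" and s: "s \<in> interior (dual_cone K)"
    using assms(7) by (auto simp: nbhd_def conic_domain_def interior_Times)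
  have near: "sqrt (\<psi> \<bullet> (matrix_inv H *v \<psi>)) \<le> \<eta> * \<mu>"
    using assms(7) by (simp add: nbhd_def dual_local_norm_def \<psi>_def \<mu>_def H_def)
  have \<nu>: "1 \<le> \<nu>" by (rule LHSCB_parameter_ge_1[OF K L x])
  have "x \<noteq> 0" using x proper_cone_zero_notin_interior[OF K] by auto
  then have "0 < x \<bullet> s"
    using inner_interior_dual_cone_pos[OF s] x interior_subset by blast
  then have \<mu>: "0 < \<mu>" using \<nu> by (simp add: \<mu>_def mu_def)
  have H: "v \<bullet> (H *v w) = dir_deriv F [v, w] x" for v w
    unfolding H_def by (rule hess_inner[OF C2 open_interior x])
  have g: "g \<bullet> v = dir_deriv F [v] x" for v
    unfolding g_def by (rule grad_inner[OF C2 open_interior x]) simp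
  have symH: "transpose H = H"
    unfolding H_def by (rule transpose_hess[OF C2 open_interior x])
  have posH: "0 < v \<bullet> (H *v v)" if "v \<noteq> 0" for v
    using LHSCB_dir_deriv2_pos[OF K L x that] by (simp add: H)
  then have nonnegH: "0 \<le> v \<bullet> (H *v v)" for v
    by (cases "v = 0") (auto intro: less_imp_le)
  note CS = positive_definite_Cauchy_Schwarz[OF symH posH]
  have W: "\<bar>v \<bullet> (W *v v) - v \<bullet> (H *v v)\<bar> \<le> \<delta> * (v \<bullet> (H *v v))" for v
  proof -
    \<comment> \<open>This choice turns \<open>\<psi> \<bullet> v\<close> into the
      \<open>H\<close>-inner product of \<open>b\<close> and \<open>v\<close>, while
      \<open>\<psi> \<bullet> b\<close> is the squared dual local norm bounded by
      \<open>near\<close>.\<close>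
    define b where "b = matrix_inv H *v \<psi>"
    have Hb: "H *v b = \<psi>"
      unfolding b_def by (rule positive_definite_matrix_inv[OF posH])
    have "(\<psi> \<bullet> v)\<^sup>2 \<le> (\<psi> \<bullet> b) * (v \<bullet> (H *v v))"
      using CS[of v b] by (simp add: Hb inner_commute mult.commute)
    then have "\<bar>\<psi> \<bullet> v\<bar> \<le> sqrt (\<psi> \<bullet> b) * sqrt (v \<bullet> (H *v v))"
      using real_le_rsqrt[of "\<bar>\<psi> \<bullet> v\<bar>"] by (simp add: real_sqrt_mult[symmetric])
    also have "\<dots> \<le> \<eta> * \<mu> * sqrt (v \<bullet> (H *v v))"
      using near nonnegH by (intro mult_right_mono) (auto simp: b_def)
    finally have p: "\<bar>\<psi> \<bullet> v\<bar> \<le> \<eta> * \<mu> * sqrt (v \<bullet> (H *v v))" .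
    \<comment> \<open>Cauchy-Schwarz with first vector \<open>x\<close>: the mixed term is
      \<open>- (g \<bullet> v)\<close>, whose sign disappears in the square, and
      \<open>x \<bullet> (H *v x) = \<nu>\<close>.\<close>
    have "(g \<bullet> v)\<^sup>2 \<le> \<nu> * (v \<bullet> (H *v v))"
      using CS[of x v] by (simp add: H g LHSCB_dir_deriv2_self[OF K L x] LHSCB_dir_deriv_self[OF K L x])
    then have q: "\<bar>g \<bullet> v\<bar> \<le> sqrt \<nu> * sqrt (v \<bullet> (H *v v))"
      using real_le_rsqrt[of "\<bar>g \<bullet> v\<bar>"] by (simp add: real_sqrt_mult[symmetric])
    have "s \<bullet> v = \<psi> \<bullet> v - \<mu> * (g \<bullet> v)"
      by (simp add: \<psi>_def psi_def g_def inner_add_left)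
    then have "v \<bullet> (W *v v) - v \<bullet> (H *v v) =
        (\<psi> \<bullet> v - \<mu> * (g \<bullet> v))\<^sup>2 / (\<nu> * \<mu>\<^sup>2) - (g \<bullet> v)\<^sup>2 / \<nu>"
      by (simp add: W_def matrix_vector_mult_add_rdistrib matrix_vector_mult_diff_rdistrib
          scaleR_matrix_vector_assoc[symmetric] outer_prod_vector_mult inner_add_right
          inner_diff_right inner_commute[of v] power2_eq_square)
    then show ?thesis
      unfolding \<delta>_def using rank_two_update_bound[OF \<nu> \<mu> _ nonnegH p q] assms(5) by simp
  qed
  \<comment> \<open>The order \<open>\<preceq>\<^sub>L\<close> also demands symmetry of both
    sides.\<close>
  have "transpose W = W"
    using symH by (simp add: W_def transpose_def vec_eq_iff outer_prod_def matrix_matrix_mult_def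
        columnvector_def rowvector_def mult.commute)
  then have "(1 - \<delta>) *\<^sub>R H \<preceq>\<^sub>L W \<and> W \<preceq>\<^sub>L (1 + \<delta>) *\<^sub>R H"
    using W by (simp add: loewner_le_def transpose_scalar symH matrix_vector_mult_diff_rdistrib
        scaleR_matrix_vector_assoc[symmetric] inner_diff_right left_diff_distrib distrib_right abs_le_iff
        diff_le_eq add.commute)
  moreover have "\<delta> < 1"
  proof -
    \<comment> \<open>The left side is \<open>\<delta> + 1\<close> and the right side is 2.\<close>
    have "(\<eta> + 1)\<^sup>2 < (sqrt 2)\<^sup>2"
      using assms(5,6) by (intro power_strict_mono) auto
    then show ?thesis by (simp add: \<delta>_def power2_eq_square algebra_simps)
  qed
  ultimately show ?thesis
    by (simp add: Let_def \<mu>_def g_def H_def W_def \<delta>_def)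
qed

end
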